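(* For each $N\ge1$ let $\mathbb{P}_N$ be a real orthogonal polynomial (OP) ensemble of $N$ points with recurrence coefficients $(a_k^N)_{k\ge0}$, $(b_k^N)_{k\ge0}$. If there exist $a>0$ and $b\in\mathbb{R}$ such that, for every fixed $k\in\mathbb{Z}$, $a_{N+k}^N\to a$ and $b_{N+k}^N\to b$ as $N\to\infty$, then the probability measures $$Q_N(dx,dy)=\frac1{2(a_{N-1}^N)^2}(x-y)^2K_N(x,y)^2\,\mu_N(dx)\mu_N(dy)$$ on $\mathbb{R}\times\mathbb{R}$ converge in moments, as $N\to\infty$, towards $$Q(dx,dy)=\frac{4a^2-(x-b)(y-b)}{4\pi^2a^2\sqrt{4a^2-(x-b)^2}\sqrt{4a^2-(y-b)^2}}\,\mathbf 1_{[-2a+b,2a+b]^2}(x,y)\,dx\,dy,$$ that is, $\iint x^my^n\,Q_N(dx,dy)\to\iint x^my^n\,Q(dx,dy)$ for all integers $m,n\ge0$.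
   Context: Real OP ensemble: for each $N\ge1$, $\mu_N$ is a Borel measure on $\mathbb{R}$ with infinite support such that all polynomials belong to $L^2(\mu_N)$; $(P_k^N)_{k\ge0}$ are its orthonormal polynomials, $\deg P_k^N=k$ (with positive leading coefficient, as usual); $K_N(x,y)=\sum_{k=0}^{N-1}P_k^N(x)P_k^N(y)$; and $\mathbb{P}_N$ is the probability measure on $\mathbb{R}^N$ given by $d\mathbb{P}_N(x_1,\dots,x_N)=\frac1{N!}\det[K_N(x_i,x_j)]_{i,j=1}^N\prod_{i=1}^N\mu_N(dx_i)$. The recurrence coefficients are $a_k^N=\langle xP_k^N,P_{k+1}^N\rangle_{L^2(\mu_N)}$ and $b_k^N=\langle xP_k^N,P_k^N\rangle_{L^2(\mu_N)}$ for $k\ge0$, so that $xP_k^N=a_k^NP_{k+1}^N+b_k^NP_k^N+a_{k-1}^NP_{k-1}^N$ with $a_{-1}^N=0$. *)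

theory Defs
  imports "HOL-Probability.Probability" "Jordan_Normal_Form.Determinant"
begin

definition measure_support :: "real measure \<Rightarrow> real set" where
  "measure_support M = {x. \<forall>U. open U \<and> x \<in> U \<longrightarrow> emeasure M U > 0}"

definition admissible_measure :: "real measure \<Rightarrow> bool" where
  "admissible_measure M \<longleftrightarrow>
     sets M = sets borel \<and>
     infinite (measure_support M) \<and>
     (\<forall>p :: real poly. integrable M (\<lambda>x. (poly p x)\<^sup>2))"

definition L2_inner :: "real measure \<Rightarrow> real poly \<Rightarrow> real poly \<Rightarrow> real" where
  "L2_inner M p q = (\<integral>x. poly p x * poly q x \<partial>M)"

text \<open>For an admissible measure there is exactly one such sequence.\<close>

definition orthonormal_polys :: "real measure \<Rightarrow> (nat \<Rightarrow> real poly) \<Rightarrow> bool" where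
  "orthonormal_polys M P \<longleftrightarrow>
     (\<forall>k. Polynomial.degree (P k) = k \<and> Polynomial.lead_coeff (P k) > 0) \<and>
     (\<forall>j k. L2_inner M (P j) (P k) = (if j = k then 1 else 0))"

definition CD_kernel :: "(nat \<Rightarrow> real poly) \<Rightarrow> nat \<Rightarrow> real \<Rightarrow> real \<Rightarrow> real" where
  "CD_kernel P N x y = (\<Sum>k<N. poly (P k) x * poly (P k) y)"

text \<open>Points of \<open>\<real>\<^sup>N\<close> are functions on the index set \<open>{..<N}\<close>,
  so the coordinates are numbered from \<open>0\<close>. The density is nonnegative, being a multiple
  of a Gram determinant, so \<open>ennreal\<close> does not truncate it.\<close>

definition OP_law :: "nat \<Rightarrow> real measure \<Rightarrow> (nat \<Rightarrow> real poly) \<Rightarrow> (nat \<Rightarrow> real) measure" where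
  "OP_law N M P =
     density (PiM {..<N} (\<lambda>_. M))
       (\<lambda>x. ennreal (1 / fact N *
          Determinant.det (Matrix.mat N N (\<lambda>(i, j). CD_kernel P N (x i) (x j)))))"

definition real_OP_ensemble ::
  "nat \<Rightarrow> real measure \<Rightarrow> (nat \<Rightarrow> real poly) \<Rightarrow> (nat \<Rightarrow> real) measure \<Rightarrow> bool" where
  "real_OP_ensemble N M P \<P> \<longleftrightarrow>
     admissible_measure M \<and> orthonormal_polys M P \<and> \<P> = OP_law N M P"

definition rec_a :: "real measure \<Rightarrow> (nat \<Rightarrow> real poly) \<Rightarrow> nat \<Rightarrow> real" where
  "rec_a M P k = L2_inner M ([:0, 1:] * P k) (P (k + 1))"

definition rec_b :: "real measure \<Rightarrow> (nat \<Rightarrow> real poly) \<Rightarrow> nat \<Rightarrow> real" where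
  "rec_b M P k = L2_inner M ([:0, 1:] * P k) (P k)"

definition Q_measure ::
  "nat \<Rightarrow> real measure \<Rightarrow> (nat \<Rightarrow> real poly) \<Rightarrow> (real \<times> real) measure" where
  "Q_measure N M P =
     density (M \<Otimes>\<^sub>M M)
       (\<lambda>(x, y). ennreal (1 / (2 * (rec_a M P (N - 1))\<^sup>2) * (x - y)\<^sup>2 * (CD_kernel P N x y)\<^sup>2))"

text \<open>The quotient takes the value \<open>0\<close> on the boundary of the square, which is a
  null set, and is nonnegative inside.\<close>

definition Q_limit :: "real \<Rightarrow> real \<Rightarrow> (real \<times> real) measure" where
  "Q_limit a b =
     density (lborel \<Otimes>\<^sub>M lborel)
       (\<lambda>(x, y). ennreal
          ((4 * a\<^sup>2 - (x - b) * (y - b)) /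
             (4 * pi\<^sup>2 * a\<^sup>2 * sqrt (4 * a\<^sup>2 - (x - b)\<^sup>2) * sqrt (4 * a\<^sup>2 - (y - b)\<^sup>2))
           * indicator ({- 2 * a + b .. 2 * a + b} \<times> {- 2 * a + b .. 2 * a + b}) (x, y)))"

text \<open>The sequence is indexed by \<open>N \<ge> 1\<close>; the value at \<open>0\<close> is irrelevant. Integrability
  is part of the notion because the Bochner integral of a non-integrable function is \<open>0\<close>.\<close>

definition converges_in_moments ::
  "(nat \<Rightarrow> (real \<times> real) measure) \<Rightarrow> (real \<times> real) measure \<Rightarrow> bool" where
  "converges_in_moments M L \<longleftrightarrow>
     (\<forall>m n. (\<forall>N\<ge>1. integrable (M N) (\<lambda>(x, y). x ^ m * y ^ n)) \<and>
            integrable L (\<lambda>(x, y). x ^ m * y ^ n) \<and>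
            (\<lambda>N. \<integral>(x, y). x ^ m * y ^ n \<partial>M N)
              \<longlonglongrightarrow> (\<integral>(x, y). x ^ m * y ^ n \<partial>L))"

end

(* By the Christoffel-Darboux formula Q_N has density
     1/2 (P_N(x) P_{N-1}(y) - P_{N-1}(x) P_N(y))^2,
   so its moments are polynomials in the matrix entries <x^m P_{N+i}, P_{N+j}>. These are sums over
   lattice paths weighted by recurrence coefficients near index N, hence converge to the entries of
   the m-th power of the two-sided Toeplitz Jacobi matrix with constant coefficients a and b, which
   are the Fourier coefficients of (b + 2a cos t)^m. The substitution x = b + 2a cos t turns the
   moments of Q into the same expressions. *)
theory Submission
  imports Defs
begin

section \<open>Integrals of products and densities\<close>

lemma has_bochner_integral_pair_mult:
  fixes f g :: "_ \<Rightarrow> real"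
  assumes "sigma_finite_measure M" "sigma_finite_measure N" "integrable M f" "integrable N g"
  shows "has_bochner_integral (M \<Otimes>\<^sub>M N) (\<lambda>(x, y). f x * g y)
           (integral\<^sup>L M f * integral\<^sup>L N g)"
proof -
  have psf: "pair_sigma_finite M N"
    using assms by (simp add: pair_sigma_finite_def)
  have [measurable]: "f \<in> borel_measurable M" "g \<in> borel_measurable N"
    using assms by auto
  have int: "integrable (M \<Otimes>\<^sub>M N) (\<lambda>(x, y). f x * g y)"
  proof (rule pair_sigma_finite.Fubini_integrable[OF psf])
    show "integrable M (\<lambda>x. \<integral>y. norm (case (x, y) of (x, y) \<Rightarrow> f x * g y) \<partial>N)"
      using assms by (simp add: abs_mult)
    show "AE x in M. integrable N (\<lambda>y. case (x, y) of (x, y) \<Rightarrow> f x * g y)"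
      using assms by simp
  qed measurable
  then show ?thesis
    using pair_sigma_finite.integral_fst'[OF psf int] by (simp add: has_bochner_integral_iff)
qed

lemma prob_space_density_real:
  assumes "has_bochner_integral M f (1 :: real)" "\<And>x. f x \<ge> 0"
  shows "prob_space (density M (\<lambda>x. ennreal (f x)))"
proof (rule prob_spaceI)
  have [measurable]: "f \<in> borel_measurable M" and "integrable M f"
    using assms(1) by (auto simp: has_bochner_integral_iff)
  have "emeasure (density M (\<lambda>x. ennreal (f x))) (space M) = (\<integral>\<^sup>+x. ennreal (f x) \<partial>M)"
    by (simp add: emeasure_density cong: nn_integral_cong)
  also have "\<dots> = 1"
    using assms by (subst nn_integral_eq_integral) (auto simp: has_bochner_integral_iff)
  finally show "emeasure (density M (\<lambda>x. ennreal (f x)))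
      (space (density M (\<lambda>x. ennreal (f x)))) = 1" by simp
qed

lemma has_bochner_integral_density_real:
  fixes f h :: "_ \<Rightarrow> real"
  assumes "has_bochner_integral M (\<lambda>x. f x * h x) v" "f \<in> borel_measurable M"
    "h \<in> borel_measurable M" "\<And>x. f x \<ge> 0"
  shows "has_bochner_integral (density M (\<lambda>x. ennreal (f x))) h v"
  using assms by (simp add: has_bochner_integral_iff integrable_real_density integral_real_density)

section \<open>Orthonormal polynomials of an admissible measure and their three-term
  recurrence\<close>

context
  fixes M :: "real measure" and P :: "nat \<Rightarrow> real poly"
  assumes admissible: "admissible_measure M"
    and orthonormal: "orthonormal_polys M P"
begin

lemma sets_eq: "sets M = sets borel"
  using admissible by (simp add: admissible_measure_def)

lemma poly_measurable: "poly p \<in> borel_measurable M"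
proof -
  have "poly p \<in> borel_measurable borel"
    by (intro borel_measurable_continuous_onI continuous_intros)
  then show ?thesis by (simp add: measurable_cong_sets[OF sets_eq refl])
qed

text \<open>Admissibility only speaks of squares. Polarization,
  \<open>2 * p = (p + 1)^2 - p^2 - 1^2\<close>, writes any polynomial as a combination of
  squares.\<close>

lemma integrable_poly: "integrable M (\<lambda>x. poly p x)"
proof -
  have sq: "integrable M (\<lambda>x. (poly q x)\<^sup>2)" for q
    using admissible by (simp add: admissible_measure_def)
  have "integrable M (\<lambda>x. ((poly (p + 1) x)\<^sup>2 - (poly p x)\<^sup>2 - (poly 1 x)\<^sup>2) / 2)"
    by (intro Bochner_Integration.integrable_diff integrable_divide sq)
  then show ?thesis by (simp add: power2_sum)
qed

text \<open>The constant 1 is a polynomial, so the measure is even finite. Sigma-finiteness is what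
  Fubini asks for on the product measure underlying \<open>Q_measure\<close>.\<close>

lemma sigma_finite: "sigma_finite_measure M"
proof (rule finite_measure.axioms(1), rule finite_measureI)
  have "integrable M (\<lambda>x. 1 :: real)"
    using integrable_poly[of 1] unfolding Polynomial.poly_1 .
  then show "emeasure M (space M) \<noteq> \<infinity>"
    by (simp add: integrable_iff_bounded less_top)
qed

lemma integrable_poly_mult: "integrable M (\<lambda>x. poly p x * poly q x)"
  using integrable_poly[of "p * q"] unfolding Polynomial.poly_mult .

lemma L2_inner_commute: "L2_inner M p q = L2_inner M q p"
  by (simp add: L2_inner_def mult.commute)

lemma L2_inner_add_left: "L2_inner M (p + q) r = L2_inner M p r + L2_inner M q r"
  by (simp add: L2_inner_def algebra_simps integrable_poly_mult)

lemma L2_inner_smult_left: "L2_inner M (Polynomial.smult c p) r = c * L2_inner M p r"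
  by (simp add: L2_inner_def algebra_simps)

lemma L2_inner_sum_left: "L2_inner M (\<Sum>i\<in>A. f i) r = (\<Sum>i\<in>A. L2_inner M (f i) r)"
proof (induction A rule: infinite_finite_induct)
  case (insert x F)
  then show ?case by (simp add: L2_inner_add_left)
qed (simp_all add: L2_inner_def)

lemma L2_inner_mult_left: "L2_inner M (s * p) q = L2_inner M p (s * q)"
  by (simp add: L2_inner_def algebra_simps)

lemma L2_inner_P: "L2_inner M (P j) (P k) = (if j = k then 1 else 0)"
  and degree_P: "Polynomial.degree (P k) = k"
  and lead_coeff_P: "Polynomial.lead_coeff (P k) > 0"
  using orthonormal unfolding orthonormal_polys_def by blast+

lemma ex_P_combination:
  assumes "Polynomial.degree q \<le> n"
  shows "\<exists>c. q = (\<Sum>k\<le>n. Polynomial.smult (c k) (P k))"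
  using assms
proof (induction n arbitrary: q)
  case 0
  then obtain d where d: "q = [:d:]" by (metis degree_0_id le_zero_eq)
  obtain e where e: "P 0 = [:e:]" by (metis degree_0_id degree_P)
  have "e \<noteq> 0" using lead_coeff_P[of 0] e by auto
  then show ?case
    by (intro exI[of _ "\<lambda>_. d / e"]) (simp add: d e)
next
  case (Suc n)
  \<comment> \<open>\<open>t\<close> is chosen so that subtracting \<open>t\<close> times
    \<open>P (Suc n)\<close> cancels the coefficient of degree \<open>Suc n\<close>; the remainder
    \<open>r\<close> falls under the induction hypothesis.\<close>
  define t where "t = Polynomial.coeff q (Suc n) / Polynomial.lead_coeff (P (Suc n))"
  define r where "r = q - Polynomial.smult t (P (Suc n))"
  have "Polynomial.degree r \<le> n"
  proof (rule Polynomial.degree_le, intro allI impI)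
    fix i assume "n < i"
    then consider "i = Suc n" | "i > Suc n" by linarith
    then show "Polynomial.coeff r i = 0"
    proof cases
      case 1
      then show ?thesis
        using lead_coeff_P[of "Suc n"] by (simp add: r_def t_def degree_P)
    next
      case 2
      then show ?thesis
        using Suc.prems by (simp add: r_def Polynomial.coeff_eq_0 degree_P)
    qed
  qed
  then obtain c where c: "r = (\<Sum>k\<le>n. Polynomial.smult (c k) (P k))"
    using Suc.IH by blast
  have "q = (\<Sum>k\<le>Suc n. Polynomial.smult ((c(Suc n := t)) k) (P k))"
    using c by (simp add: r_def algebra_simps)
  then show ?case by blast
qed

lemma P_expansion:
  assumes "Polynomial.degree q \<le> n"
  shows "q = (\<Sum>k\<le>n. Polynomial.smult (L2_inner M q (P k)) (P k))"
proof -
  obtain c where c: "q = (\<Sum>k\<le>n. Polynomial.smult (c k) (P k))"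
    using ex_P_combination[OF assms] by blast
  have "L2_inner M q (P j) = c j" if "j \<le> n" for j
    using that by (simp add: c L2_inner_sum_left L2_inner_smult_left L2_inner_P if_distrib cong: if_cong)
  with c show ?thesis by (metis (no_types, lifting) atMost_iff sum.cong)
qed

lemma L2_inner_P_eq_0:
  assumes "Polynomial.degree q < j"
  shows "L2_inner M q (P j) = 0"
proof -
  have "L2_inner M q (P j)
      = L2_inner M (\<Sum>k\<le>Polynomial.degree q. Polynomial.smult (L2_inner M q (P k)) (P k)) (P j)"
    using P_expansion[OF order_refl] by simp
  also have "\<dots> = 0"
    using assms by (simp add: L2_inner_sum_left L2_inner_smult_left L2_inner_P)
  finally show ?thesis .
qed

lemma degree_x_P: "Polynomial.degree ([:0, 1:] * P k) = Suc k"
proof -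
  have "P k \<noteq> 0" using lead_coeff_P[of k] by auto
  then show ?thesis by (simp add: degree_P)
qed

text \<open>Multiplication by x is symmetric, so the coefficient of \<open>x * P k\<close> along
  \<open>P j\<close> is also that of \<open>x * P j\<close> along \<open>P k\<close>. It vanishes
  for \<open>j + 1 < k\<close> by degree, and only three neighbours of \<open>k\<close> survive. The
  case \<open>k = 0\<close> is split off because \<open>0 - 1 = 0\<close> on naturals would count
  \<open>P 0\<close> twice.\<close>

lemma x_P_expansion:
  "[:0, 1:] * P k = Polynomial.smult (rec_a M P k) (P (Suc k)) + Polynomial.smult (rec_b M P k) (P k)
     + (if k = 0 then 0 else Polynomial.smult (rec_a M P (k - 1)) (P (k - 1)))"
proof -
  let ?c = "\<lambda>j. Polynomial.smult (L2_inner M ([:0, 1:] * P k) (P j)) (P j)"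
  have zero: "L2_inner M ([:0, 1:] * P k) (P j) = 0" if "Suc j < k" for j
    using that L2_inner_P_eq_0[of "[:0, 1:] * P j" k] degree_x_P[of j]
    by (metis L2_inner_commute L2_inner_mult_left)
  have "[:0, 1:] * P k = (\<Sum>j\<le>Suc k. ?c j)"
    by (rule P_expansion) (simp only: degree_x_P)
  also have "\<dots> = ?c (Suc k) + ?c k + (\<Sum>j<k. ?c j)"
    by (simp only: sum.atMost_Suc lessThan_Suc_atMost[symmetric] sum.lessThan_Suc ac_simps)
  also have "(\<Sum>j<k. ?c j) = (if k = 0 then 0 else ?c (k - 1))"
  proof (cases k)
    case (Suc l)
    have "(\<Sum>j<l. ?c j) = 0"
      by (rule sum.neutral) (use zero Suc in \<open>simp del: mult_pCons_left\<close>)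
    then show ?thesis by (simp add: Suc del: mult_pCons_left)
  qed simp
  \<comment> \<open>By symmetry the lower coefficient is the inner product of
    \<open>x * P (k - 1)\<close> with \<open>P k\<close>, which is \<open>rec_a M P (k - 1)\<close>
    because \<open>k - 1 + 1 = k\<close> for positive \<open>k\<close>.\<close>
  also have "(if k = 0 then 0 else ?c (k - 1))
      = (if k = 0 then 0 else Polynomial.smult (rec_a M P (k - 1)) (P (k - 1)))"
    using L2_inner_mult_left[of "[:0, 1:]" "P k" "P (k - 1)"]
      L2_inner_commute[of "P k" "[:0, 1:] * P (k - 1)"]
    by (simp add: rec_a_def del: mult_pCons_left)
  finally show ?thesis by (simp add: rec_a_def rec_b_def)
qed

text \<open>If \<open>rec_a M P k\<close> were 0, the right side of the recurrence would have degree
  at most \<open>k\<close>, while \<open>x * P k\<close> has degree \<open>k + 1\<close>. This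
  allows the prefactor of \<open>Q_measure\<close> to be cancelled.\<close>

lemma rec_a_neq_0: "rec_a M P k \<noteq> 0"
proof
  assume 0: "rec_a M P k = 0"
  have "Polynomial.coeff ([:0, 1:] * P k) (Suc k) = 0"
    by (subst x_P_expansion) (auto simp: 0 Polynomial.coeff_eq_0 degree_P)
  moreover have "Polynomial.coeff ([:0, 1:] * P k) (Suc k) = Polynomial.lead_coeff (P k)"
    by (simp add: degree_P)
  ultimately show False using lead_coeff_P[of k] by simp
qed

section \<open>The Christoffel-Darboux formula and the moments of \<open>Q_measure\<close>\<close>

lemma three_term_recurrence:
  "x * poly (P k) x = rec_a M P k * poly (P (Suc k)) x + rec_b M P k * poly (P k) x
     + (if k = 0 then 0 else rec_a M P (k - 1) * poly (P (k - 1)) x)"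
  using arg_cong[OF x_P_expansion[of k], of "\<lambda>p. poly p x"] by auto

text \<open>Telescoping: when \<open>n\<close> grows by one, the left side gains
  \<open>(x - y) * P (n+1) x * P (n+1) y\<close>. Applying the recurrence once in x and once in y,
  the \<open>rec_b\<close> terms cancel and the lower \<open>rec_a\<close> terms cancel the previous
  right side.\<close>

lemma Christoffel_Darboux:
  "(x - y) * CD_kernel P (Suc n) x y
     = rec_a M P n * (poly (P (Suc n)) x * poly (P n) y - poly (P n) x * poly (P (Suc n)) y)"
proof (induction n)
  case 0
  show ?case
  proof -
    have "(x - y) * CD_kernel P (Suc 0) x y
        = (x * poly (P 0) x) * poly (P 0) y - poly (P 0) x * (y * poly (P 0) y)"
      by (simp add: CD_kernel_def algebra_simps)
    then show ?thesis
      unfolding three_term_recurrence[of _ 0] by (simp add: algebra_simps)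
  qed
next
  case (Suc n)
  have "(x - y) * CD_kernel P (Suc (Suc n)) x y = (x - y) * CD_kernel P (Suc n) x y
      + (x * poly (P (Suc n)) x) * poly (P (Suc n)) y - poly (P (Suc n)) x * (y * poly (P (Suc n)) y)"
    by (simp add: CD_kernel_def algebra_simps)
  also have "\<dots> = rec_a M P (Suc n)
      * (poly (P (Suc (Suc n))) x * poly (P (Suc n)) y - poly (P (Suc n)) x * poly (P (Suc (Suc n))) y)"
    unfolding Suc.IH three_term_recurrence[of _ "Suc n"] by (simp add: algebra_simps)
  finally show ?case .
qed

text \<open>By Christoffel-Darboux, \<open>(x - y)^2 * K^2\<close> is \<open>a_(N-1)^2\<close> times
  the square of a 2 by 2 determinant, so the prefactor leaves half of that square. Expanding it
  gives products of a function of x and a function of y, whose integrals are entries of powers of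
  the Jacobi matrix at the indices \<open>N\<close> and \<open>N - 1\<close>.\<close>

lemma Q_measure_moments:
  fixes m n :: nat
  assumes N: "N \<ge> 1"
  defines "I \<equiv> \<lambda>m i j. L2_inner M ([:0, 1:] ^ m * P i) (P j)"
  shows "has_bochner_integral (Q_measure N M P) (\<lambda>(x, y). x ^ m * y ^ n)
    ((I m N N * I n (N - 1) (N - 1) + I m (N - 1) (N - 1) * I n N N) / 2
       - I m N (N - 1) * I n N (N - 1))" (is ?moment)
    and "prob_space (Q_measure N M P)" (is ?prob)
proof -
  obtain l where l: "N = Suc l" using N by (cases N) auto
  define p q where "p = (\<lambda>x. poly (P N) x)" and "q = (\<lambda>x. poly (P l) x)"
  define D where "D = (\<lambda>(x, y). (p x * q y - q x * p y)\<^sup>2 / 2)"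
  have [measurable]: "p \<in> borel_measurable M" "q \<in> borel_measurable M"
    unfolding p_def q_def by (rule poly_measurable)+
  have [measurable]: "D \<in> borel_measurable (M \<Otimes>\<^sub>M M)"
    unfolding D_def by measurable
  have D_nonneg: "D z \<ge> 0" for z by (simp add: D_def split: prod.split)
  have D_eq: "1 / (2 * (rec_a M P (N - 1))\<^sup>2) * (x - y)\<^sup>2 * (CD_kernel P N x y)\<^sup>2 = D (x, y)" for x y
  proof -
    have "(x - y)\<^sup>2 * (CD_kernel P N x y)\<^sup>2 = ((x - y) * CD_kernel P (Suc l) x y)\<^sup>2"
      by (simp add: l power_mult_distrib)
    also have "\<dots> = (rec_a M P l)\<^sup>2 * (p x * q y - q x * p y)\<^sup>2"
      by (simp add: Christoffel_Darboux power_mult_distrib p_def q_def l)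
    finally show ?thesis using rec_a_neq_0[of l] by (simp add: D_def l mult.assoc)
  qed
  have Q: "Q_measure N M P = density (M \<Otimes>\<^sub>M M) (\<lambda>z. ennreal (D z))"
    unfolding Q_measure_def case_prod_unfold D_eq prod.collapse ..
  have int: "integrable M (\<lambda>x. x ^ m * (poly (P i) x * poly (P j) x))" for m i j
    using integrable_poly_mult[of "[:0, 1:] ^ m * P i" "P j"] by (simp add: mult.assoc)
  have val: "(\<integral>x. x ^ m * (poly (P i) x * poly (P j) x) \<partial>M) = I m i j" for m i j
    by (simp add: I_def L2_inner_def mult.assoc)
  have pair: "has_bochner_integral (M \<Otimes>\<^sub>M M)
      (\<lambda>(x, y). (x ^ m * (poly (P i) x * poly (P j) x)) * (y ^ n * (poly (P i') y * poly (P j') y)))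
      (I m i j * I n i' j')" for m n i j i' j'
    using has_bochner_integral_pair_mult[OF sigma_finite sigma_finite
        int[of m i j] int[of n i' j']] by (simp add: val)
  have DI: "has_bochner_integral (M \<Otimes>\<^sub>M M) (\<lambda>z. D z * (case z of (x, y) \<Rightarrow> x ^ m * y ^ n))
    ((I m N N * I n l l + I m l l * I n N N) / 2 - I m N l * I n N l)" for m n
  proof (rule has_bochner_integral_cong[THEN iffD1, OF refl _ refl])
    \<comment> \<open>The expanded square: two diagonal products, averaged, minus the mixed
      product.\<close>
    show "has_bochner_integral (M \<Otimes>\<^sub>M M) (\<lambda>z.
       ((case z of (x, y) \<Rightarrow> (x ^ m * (poly (P N) x * poly (P N) x)) * (y ^ n * (poly (P l) y * poly (P l) y)))
       + (case z of (x, y) \<Rightarrow> (x ^ m * (poly (P l) x * poly (P l) x)) * (y ^ n * (poly (P N) y * poly (P N) y)))) / 2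
       - (case z of (x, y) \<Rightarrow> (x ^ m * (poly (P N) x * poly (P l) x)) * (y ^ n * (poly (P N) y * poly (P l) y))))
      ((I m N N * I n l l + I m l l * I n N N) / 2 - I m N l * I n N l)"
      by (intro has_bochner_integral_diff has_bochner_integral_divide has_bochner_integral_add pair)
  qed (simp add: D_def p_def q_def power2_eq_square field_simps split: prod.split)
  note [measurable_cong] = sets_eq
  have meas: "(\<lambda>(x, y). x ^ m * y ^ n) \<in> borel_measurable (M \<Otimes>\<^sub>M M)"
    by measurable
  show ?moment
    using has_bochner_integral_density_real[OF DI _ meas] D_nonneg unfolding Q by (simp add: l)
  show ?prob
    unfolding Q
  proof (rule prob_space_density_real[OF _ D_nonneg])
    \<comment> \<open>The moment \<open>m = n = 0\<close>: orthonormality turns the formula into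
      \<open>(1 + 1) / 2 - 0 = 1\<close>.\<close>
    show "has_bochner_integral (M \<Otimes>\<^sub>M M) D 1"
      using DI[of 0 0] by (simp add: case_prod_unfold I_def L2_inner_P l)
  qed
qed

end

section \<open>The arcsine law on \<open>[b - 2a, b + 2a]\<close> and its cosine moments\<close>

text \<open>For \<open>a > 0\<close> this is the law of \<open>b + 2a cos t\<close> with t uniform
  on a half period. At the endpoints the square root is 0, and the quotient is 0 by
  convention.\<close>

definition arcsine_density :: "real \<Rightarrow> real \<Rightarrow> real \<Rightarrow> real" where
  "arcsine_density a b x =
     indicator {- 2 * a + b .. 2 * a + b} x / (pi * sqrt (4 * a\<^sup>2 - (x - b)\<^sup>2))"

text \<open>The \<open>d\<close>-th Fourier coefficient of \<open>(b + 2a cos t)^m\<close>, that is,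
  the entry at distance \<open>d\<close> from the diagonal of the \<open>m\<close>-th power of the
  two-sided Toeplitz Jacobi matrix. Since the integrand is even, a half period suffices. An integer
  \<open>d\<close> lets the recursion step to \<open>d - 1\<close> without a boundary case.\<close>

definition cos_moment :: "real \<Rightarrow> real \<Rightarrow> nat \<Rightarrow> int \<Rightarrow> real" where
  "cos_moment a b m d =
     (LBINT t. (b + 2 * a * cos t) ^ m * cos (of_int d * t) * indicator {-pi..0} t) / pi"

lemma arcsine_density_nonneg: "arcsine_density a b x \<ge> 0"
proof (cases "x \<in> {- 2 * a + b .. 2 * a + b}")
  case True
  then have "(x - b)\<^sup>2 \<le> (2 * a)\<^sup>2"
    by (intro abs_le_square_iff[THEN iffD1]) auto
  then show ?thesis by (simp add: arcsine_density_def power_mult_distrib)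
qed (simp add: arcsine_density_def)

lemma arcsine_measurable [measurable]: "arcsine_density a b \<in> borel_measurable borel"
  unfolding arcsine_density_def by measurable

text \<open>The substitution \<open>x = b + 2a cos t\<close> runs over \<open>[-\<pi>, 0]\<close> because the library
  requires it to be increasing.\<close>

lemma arcsine_integral:
  fixes h :: "real \<Rightarrow> real"
  assumes a: "a > 0" and h: "continuous_on UNIV h"
  shows "has_bochner_integral lborel (\<lambda>x. h x * arcsine_density a b x)
           ((LBINT t. h (b + 2 * a * cos t) * indicator {-pi..0} t) / pi)"
proof -
  let ?g = "\<lambda>t. b + 2 * a * cos t" and ?g' = "\<lambda>t. - 2 * a * sin t"
  let ?w = "\<lambda>x. 1 / (pi * sqrt (4 * a\<^sup>2 - (x - b)\<^sup>2))"
  have I: "{?g (-pi) .. ?g 0} = {- 2 * a + b .. 2 * a + b}" by (simp add: add.commute)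
  have dg: "(?g has_real_derivative ?g' t) (at t)" for t
    by (auto intro!: derivative_eq_intros)
  have cg': "continuous_on {-pi..0} ?g'" by (intro continuous_intros)
  have sn: "sin t \<le> 0" if "t \<in> {-pi..0}" for t
    using that sin_ge_zero[of "-t"] by simp
  have g'0: "?g' t \<ge> 0" if "t \<in> {-pi..0}" for t
    using sn[OF that] a by (simp add: mult_nonneg_nonpos)
  \<comment> \<open>The Jacobian cancels the weight exactly. This holds only in the open interval:
    at the endpoints both factors are 0, hence the almost-everywhere statements below.\<close>
  have wg: "?w (?g t) * ?g' t = 1 / pi" if "t \<in> {-pi<..<0}" for t
  proof -
    have s: "sin t < 0" using that sin_gt_zero[of "-t"] by simp
    have "4 * a\<^sup>2 - (?g t - b)\<^sup>2 = (2 * a * sin t)\<^sup>2"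
      by (simp add: power_mult_distrib sin_squared_eq algebra_simps)
    then have "sqrt (4 * a\<^sup>2 - (?g t - b)\<^sup>2) = - (2 * a * sin t)"
      using s a by (simp only: real_sqrt_abs) (simp add: abs_mult)
    then show ?thesis using s a by (simp add: field_simps)
  qed
  have ae: "AE t in lborel. t \<noteq> -pi \<and> t \<noteq> 0"
    using AE_lborel_singleton[of "-pi"] AE_lborel_singleton[of 0] by eventually_elim simp
  \<comment> \<open>The total mass is first computed as a nonnegative integral, because the
    substitution rule for real-valued functions, used further down, presupposes
    integrability.\<close>
  have "(\<integral>\<^sup>+x. ?w x * indicator {?g (-pi) .. ?g 0} x \<partial>lborel)
      = (\<integral>\<^sup>+t. ?w (?g t) * ?g' t * indicator {-pi..0} t \<partial>lborel)"
    by (rule nn_integral_substitution[OF _ dg cg' g'0])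
      (auto simp: set_borel_measurable_def)
  also have "\<dots> = (\<integral>\<^sup>+t. ennreal (1 / pi) * indicator {-pi..0} t \<partial>lborel)"
    by (rule nn_integral_cong_AE, use ae in eventually_elim)
      (use wg in \<open>auto split: split_indicator\<close>)
  also have "\<dots> = 1"
    by (simp add: nn_integral_cmult ennreal_mult[symmetric])
  finally have fin: "(\<integral>\<^sup>+x. arcsine_density a b x \<partial>lborel) = 1"
    unfolding I by (simp add: arcsine_density_def)
  have int_w: "integrable lborel (arcsine_density a b)"
    using fin by (intro integrableI_nonneg) (auto simp: arcsine_density_nonneg)
  \<comment> \<open>A continuous \<open>h\<close> is bounded on the compact support of the weight,
    so a multiple of the weight dominates the product.\<close>
  have "bounded (h ` {- 2 * a + b .. 2 * a + b})"
    by (intro compact_imp_bounded compact_continuous_image continuous_on_subset[OF h]) auto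
  then obtain C where "\<forall>y\<in>h ` {- 2 * a + b .. 2 * a + b}. norm y \<le> C"
    unfolding bounded_iff ..
  then have C: "\<And>x. x \<in> {- 2 * a + b .. 2 * a + b} \<Longrightarrow> \<bar>h x\<bar> \<le> C"
    by simp
  have [measurable]: "h \<in> borel_measurable borel"
    using h by (rule borel_measurable_continuous_onI)
  have int_hw: "integrable lborel (\<lambda>x. h x * arcsine_density a b x)"
  proof (rule Bochner_Integration.integrable_bound)
    show "integrable lborel (\<lambda>x. C * arcsine_density a b x)"
      using int_w by simp
    show "AE x in lborel. norm (h x * arcsine_density a b x) \<le> norm (C * arcsine_density a b x)"
    proof (rule AE_I2)
      fix x
      show "norm (h x * arcsine_density a b x) \<le> norm (C * arcsine_density a b x)"
      proof (cases "x \<in> {- 2 * a + b .. 2 * a + b}")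
        case True
        then have "\<bar>h x\<bar> \<le> \<bar>C\<bar>" using C[of x] by linarith
        then show ?thesis by (simp add: abs_mult mult_right_mono)
      qed (simp add: arcsine_density_def)
    qed
  qed simp
  let ?f = "\<lambda>x. h x * ?w x"
  have hw: "h x * arcsine_density a b x = ?f x * indicator {?g (-pi) .. ?g 0} x" for x
    unfolding I by (simp add: arcsine_density_def)
  have "set_integrable lborel {?g (-pi) .. ?g 0} ?f"
    using int_hw unfolding hw set_integrable_def by (simp add: mult.commute)
  from integral_substitution(2)[OF this dg cg' g'0]
  have "(LBINT x. h x * arcsine_density a b x)
      = (LBINT t. ?f (?g t) * ?g' t * indicator {-pi..0} t)"
    unfolding hw by simp
  also have "\<dots> = (LBINT t. h (?g t) * indicator {-pi..0} t / pi)"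
  proof (rule integral_cong_AE)
    show "AE t in lborel. ?f (?g t) * ?g' t * indicator {-pi..0} t = h (?g t) * indicator {-pi..0} t / pi"
      using ae
    proof eventually_elim
      case (elim t)
      show ?case
      proof (cases "t \<in> {-pi<..<0}")
        case True
        have "?f (?g t) * ?g' t = h (?g t) * (?w (?g t) * ?g' t)" by (simp only: mult.assoc)
        then show ?thesis unfolding wg[OF True] by simp
      next
        case False
        then show ?thesis using elim by (auto split: split_indicator)
      qed
    qed
  qed measurable
  finally show ?thesis using int_hw by (simp add: has_bochner_integral_iff)
qed

lemma integrable_cos_moment:
  "integrable lborel (\<lambda>t. (b + 2 * a * cos t) ^ m * cos (of_int d * t) * indicator {-pi..0} t)"
  using borel_integrable_atLeastAtMost'[of "-pi" 0 "\<lambda>t. (b + 2 * a * cos t) ^ m * cos (of_int d * t)"]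
  by (simp add: set_integrable_def mult.commute continuous_intros)

lemma cos_moment_0: "cos_moment a b 0 d = (if d = 0 then 1 else 0)"
proof (cases "d = 0")
  case True
  then show ?thesis by (simp add: cos_moment_def)
next
  case False
  \<comment> \<open>The antiderivative \<open>sin (d t) / d\<close> vanishes at both ends, as
    \<open>d\<close> is a nonzero integer.\<close>
  have "(LBINT t. indicator {-pi..0} t *\<^sub>R cos (of_int d * t))
      = sin (of_int d * 0) / of_int d - sin (of_int d * - pi) / of_int d"
    using False
    by (intro integral_FTC_atLeastAtMost continuous_intros)
      (auto intro!: derivative_eq_intros simp flip: has_real_derivative_iff_has_vector_derivative)
  also have "\<dots> = 0"
    using sin_zero_iff_int2[of "of_int d * pi"] by auto
  finally show ?thesis using False by (simp add: cos_moment_def mult.commute)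
qed

text \<open>One factor \<open>b + 2a cos t\<close> is absorbed by
  \<open>2 cos t cos (d t) = cos ((d+1) t) + cos ((d-1) t)\<close>. The result is the three-term
  recurrence with constant coefficients, which the matrix entries of the ensembles satisfy in the
  limit.\<close>

lemma cos_moment_Suc:
  "cos_moment a b (Suc m) d
     = a * cos_moment a b m (d + 1) + b * cos_moment a b m d + a * cos_moment a b m (d - 1)"
proof -
  let ?F = "\<lambda>m d t. (b + 2 * a * cos t) ^ m * cos (of_int d * t) * indicator {-pi..0} t"
  have "?F (Suc m) d t = a * ?F m (d + 1) t + b * ?F m d t + a * ?F m (d - 1) t" for t
  proof -
    have alg: "(b + 2 * a * c) * z = a * p + b * z + a * q" if "2 * c * z = p + q" for c z p q :: real
    proof -
      have "(b + 2 * a * c) * z = b * z + a * (2 * c * z)" by (simp add: algebra_simps)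
      then show ?thesis unfolding that by (simp add: algebra_simps)
    qed
    have "2 * cos t * cos (of_int d * t) = cos (of_int (d + 1) * t) + cos (of_int (d - 1) * t)"
      by (simp add: algebra_simps cos_add cos_diff)
    then have "(b + 2 * a * cos t) * cos (of_int d * t) =
      a * cos (of_int (d + 1) * t) + b * cos (of_int d * t) + a * cos (of_int (d - 1) * t)"
      by (rule alg)
    then have "(b + 2 * a * cos t) ^ m * indicator {-pi..0} t * ((b + 2 * a * cos t) * cos (of_int d * t)) =
      (b + 2 * a * cos t) ^ m * indicator {-pi..0} t *
      (a * cos (of_int (d + 1) * t) + b * cos (of_int d * t) + a * cos (of_int (d - 1) * t))"
      by simp
    then show ?thesis by (simp add: algebra_simps)
  qed
  then have "(LBINT t. ?F (Suc m) d t) = (LBINT t. a * ?F m (d + 1) t + b * ?F m d t + a * ?F m (d - 1) t)"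
    by presburger
  also have "\<dots> = a * (LBINT t. ?F m (d + 1) t) + b * (LBINT t. ?F m d t) + a * (LBINT t. ?F m (d - 1) t)"
    by (simp only: integrable_cos_moment Bochner_Integration.integrable_add
      Bochner_Integration.integral_add integrable_mult_right integral_mult_right_zero)
  finally show ?thesis by (simp add: cos_moment_def add_divide_distrib)
qed

section \<open>Moments of the limit measure\<close>

text \<open>The density factors as \<open>w(x) w(y) (1 - (x-b)(y-b) / (4a^2))\<close> with the
  arcsine weight \<open>w\<close>. Each part is a difference of products, and the factors
  \<open>x - b = 2a cos t\<close> raise the frequency from 0 to 1 while their constants cancel
  \<open>4a^2\<close>.\<close>

lemma Q_limit_moments:
  fixes m n :: nat
  assumes a: "a > 0"
  shows "has_bochner_integral (Q_limit a b) (\<lambda>(x, y). x ^ m * y ^ n)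
    (cos_moment a b m 0 * cos_moment a b n 0 - cos_moment a b m 1 * cos_moment a b n 1)" (is ?moment)
    and "prob_space (Q_limit a b)" (is ?prob)
proof -
  let ?w = "arcsine_density a b"
  define D where "D = (\<lambda>(x, y). ?w x * ?w y - (x - b) * ?w x * ((y - b) * ?w y) / (4 * a\<^sup>2))"
  have [measurable]: "D \<in> borel_measurable (lborel \<Otimes>\<^sub>M lborel)"
    unfolding D_def by measurable
  have D_eq: "(4 * a\<^sup>2 - (x - b) * (y - b)) /
      (4 * pi\<^sup>2 * a\<^sup>2 * sqrt (4 * a\<^sup>2 - (x - b)\<^sup>2) * sqrt (4 * a\<^sup>2 - (y - b)\<^sup>2))
      * indicator ({- 2 * a + b .. 2 * a + b} \<times> {- 2 * a + b .. 2 * a + b}) (x, y) = D (x, y)" for x y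
  proof -
    have alg: "(4 * a\<^sup>2 - u * v) / (4 * pi\<^sup>2 * a\<^sup>2 * s * t) * (i * j)
        = i / (pi * s) * (j / (pi * t)) - u * (i / (pi * s)) * (v * (j / (pi * t))) / (4 * a\<^sup>2)"
      for u v s t i j :: real
      \<comment> \<open>If a square root is 0, both sides are 0 by the convention for division, so
        the identity of densities holds everywhere and not only almost everywhere.\<close>
      using a by (cases "s = 0 \<or> t = 0") (auto simp: field_simps power2_eq_square)
    show ?thesis
      unfolding D_def arcsine_density_def prod.case indicator_times fst_conv snd_conv by (rule alg)
  qed
  have D_nonneg: "D z \<ge> 0" for z
  proof -
    obtain x y where z: "z = (x, y)" by (cases z)
    show ?thesis
    proof (cases "x \<in> {- 2 * a + b .. 2 * a + b} \<and> y \<in> {- 2 * a + b .. 2 * a + b}")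
      case True
      then have "\<bar>x - b\<bar> \<le> 2 * a" "\<bar>y - b\<bar> \<le> 2 * a" by auto
      then have "\<bar>x - b\<bar> * \<bar>y - b\<bar> \<le> (2 * a) * (2 * a)"
        by (intro mult_mono) auto
      then have "(x - b) * (y - b) \<le> 4 * a\<^sup>2"
        by (simp add: power2_eq_square flip: abs_mult)
      then have "(x - b) * (y - b) / (4 * a\<^sup>2) \<le> 1"
        using a by (simp add: divide_le_eq)
      then have "0 \<le> ?w x * ?w y * (1 - (x - b) * (y - b) / (4 * a\<^sup>2))"
        by (simp add: arcsine_density_nonneg)
      also have "\<dots> = D z" by (simp add: D_def z algebra_simps)
      finally show ?thesis .
    next
      case False
      then have "?w x = 0 \<or> ?w y = 0" by (auto simp: arcsine_density_def)
      then show ?thesis by (auto simp: z D_def)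
    qed
  qed
  have Q: "Q_limit a b = density (lborel \<Otimes>\<^sub>M lborel) (\<lambda>z. ennreal (D z))"
    unfolding Q_limit_def case_prod_unfold D_eq prod.collapse ..
  have I0: "has_bochner_integral lborel (\<lambda>x. x ^ m * ?w x) (cos_moment a b m 0)" for m
    using arcsine_integral[OF a, of "\<lambda>x. x ^ m" b]
    by (simp add: cos_moment_def continuous_intros)
  have I1: "has_bochner_integral lborel (\<lambda>x. x ^ m * (x - b) * ?w x) (2 * a * cos_moment a b m 1)" for m
  proof -
    have "has_bochner_integral lborel (\<lambda>x. x ^ m * (x - b) * ?w x)
        ((LBINT t. (b + 2 * a * cos t) ^ m * (b + 2 * a * cos t - b) * indicator {-pi..0} t) / pi)"
      by (intro arcsine_integral[OF a] continuous_intros)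
    also have "(\<lambda>t. (b + 2 * a * cos t) ^ m * (b + 2 * a * cos t - b) * indicator {-pi..0} t)
       = (\<lambda>t. 2 * a * ((b + 2 * a * cos t) ^ m * cos (of_int 1 * t) * indicator {-pi..0} t))"
      by (simp add: mult_ac)
    finally show ?thesis by (simp add: cos_moment_def)
  qed
  note sf = lborel.sigma_finite_measure_axioms
  have DI: "has_bochner_integral (lborel \<Otimes>\<^sub>M lborel) (\<lambda>z. D z * (case z of (x, y) \<Rightarrow> x ^ m * y ^ n))
    (cos_moment a b m 0 * cos_moment a b n 0 - cos_moment a b m 1 * cos_moment a b n 1)" for m n
  proof (rule has_bochner_integral_cong[THEN iffD1, OF refl])
    have p0: "has_bochner_integral (lborel \<Otimes>\<^sub>M lborel) (\<lambda>(x, y). x ^ m * ?w x * (y ^ n * ?w y))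
        (cos_moment a b m 0 * cos_moment a b n 0)"
      using has_bochner_integral_pair_mult[OF sf sf, of "\<lambda>x. x ^ m * ?w x" "\<lambda>x. x ^ n * ?w x"] I0
      by (simp add: has_bochner_integral_iff)
    have p1: "has_bochner_integral (lborel \<Otimes>\<^sub>M lborel)
        (\<lambda>(x, y). x ^ m * (x - b) * ?w x * (y ^ n * (y - b) * ?w y))
        (2 * a * cos_moment a b m 1 * (2 * a * cos_moment a b n 1))"
      using has_bochner_integral_pair_mult[OF sf sf, of "\<lambda>x. x ^ m * (x - b) * ?w x"
          "\<lambda>x. x ^ n * (x - b) * ?w x"] I1
      by (simp add: has_bochner_integral_iff)
    show "has_bochner_integral (lborel \<Otimes>\<^sub>M lborel) (\<lambda>z.
        (case z of (x, y) \<Rightarrow> x ^ m * ?w x * (y ^ n * ?w y))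
        - (case z of (x, y) \<Rightarrow> x ^ m * (x - b) * ?w x * (y ^ n * (y - b) * ?w y)) / (4 * a\<^sup>2))
      (cos_moment a b m 0 * cos_moment a b n 0
        - 2 * a * cos_moment a b m 1 * (2 * a * cos_moment a b n 1) / (4 * a\<^sup>2))"
      by (intro has_bochner_integral_diff has_bochner_integral_divide p0 p1)
  qed (use a in \<open>auto simp: D_def power2_eq_square field_simps\<close>)
  have meas: "(\<lambda>(x, y). x ^ m * y ^ n :: real) \<in> borel_measurable (lborel \<Otimes>\<^sub>M lborel)"
    by measurable
  show ?moment
    unfolding Q using D_nonneg by (intro has_bochner_integral_density_real[OF DI _ meas]) auto
  show ?prob
    unfolding Q
  proof (rule prob_space_density_real[OF _ D_nonneg])
    \<comment> \<open>The moment \<open>m = n = 0\<close>: \<open>cos_moment\<close> with exponent 0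
      is 1 at frequency 0 and 0 at frequency 1.\<close>
    show "has_bochner_integral (lborel \<Otimes>\<^sub>M lborel) D 1"
      using DI[of 0 0] by (simp add: case_prod_unfold cos_moment_0)
  qed
qed

section \<open>Convergence of the entries of powers of the Jacobi matrices\<close>

text \<open>Induction on \<open>m\<close> with \<open>i\<close> free: one factor x is applied to the
  left polynomial by the recurrence, which shifts \<open>i\<close> by at most 1. The coefficients
  converge to \<open>a\<close>, \<open>b\<close>, \<open>a\<close>, and
  \<open>cos_moment_Suc\<close> is the resulting limit recursion; orthonormality starts the
  induction.\<close>

lemma L2_inner_power_limit:
  fixes \<mu> :: "nat \<Rightarrow> real measure" and P :: "nat \<Rightarrow> nat \<Rightarrow> real poly" and i j :: int
  assumes sys: "\<And>N. N \<ge> 1 \<Longrightarrow> admissible_measure (\<mu> N) \<and> orthonormal_polys (\<mu> N) (P N)"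
    and rec_a: "\<And>k :: int. (\<lambda>N. rec_a (\<mu> N) (P N) (nat (int N + k))) \<longlonglongrightarrow> a"
    and rec_b: "\<And>k :: int. (\<lambda>N. rec_b (\<mu> N) (P N) (nat (int N + k))) \<longlonglongrightarrow> b"
  shows "(\<lambda>N. L2_inner (\<mu> N) ([:0, 1:] ^ m * P N (nat (int N + i))) (P N (nat (int N + j))))
           \<longlonglongrightarrow> cos_moment a b m (i - j)"
proof (induction m arbitrary: i)
  case 0
  have "\<forall>\<^sub>F N in sequentially.
      L2_inner (\<mu> N) ([:0, 1:] ^ 0 * P N (nat (int N + i))) (P N (nat (int N + j)))
        = cos_moment a b 0 (i - j)"
    \<comment> \<open>Beyond this threshold both shifted indices are nonnegative, so
      \<open>nat\<close> does not truncate them and cannot identify distinct \<open>i\<close> and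
      \<open>j\<close>.\<close>
    using eventually_ge_at_top[of "nat (max \<bar>i\<bar> \<bar>j\<bar>) + 1"]
  proof eventually_elim
    case (elim N)
    have N: "admissible_measure (\<mu> N)" "orthonormal_polys (\<mu> N) (P N)"
      using elim sys[of N] by auto
    have "int N + i \<ge> 0" "int N + j \<ge> 0" using elim by linarith+
    then have "nat (int N + i) = nat (int N + j) \<longleftrightarrow> i = j" by (simp add: eq_nat_nat_iff)
    then show ?case by (simp add: L2_inner_P[OF N] cos_moment_0)
  qed
  then show ?case by (rule tendsto_eventually)
next
  case (Suc m)
  let ?I = "\<lambda>i N. L2_inner (\<mu> N) ([:0, 1:] ^ m * P N (nat (int N + i))) (P N (nat (int N + j)))"
  let ?S = "\<lambda>N. rec_a (\<mu> N) (P N) (nat (int N + i)) * ?I (i + 1) N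
      + rec_b (\<mu> N) (P N) (nat (int N + i)) * ?I i N
      + rec_a (\<mu> N) (P N) (nat (int N + (i - 1))) * ?I (i - 1) N"
  have "?S \<longlonglongrightarrow> a * cos_moment a b m (i + 1 - j) + b * cos_moment a b m (i - j)
      + a * cos_moment a b m (i - 1 - j)"
    by (intro tendsto_intros rec_a rec_b Suc.IH)
  also have "a * cos_moment a b m (i + 1 - j) + b * cos_moment a b m (i - j)
      + a * cos_moment a b m (i - 1 - j) = cos_moment a b (Suc m) (i - j)"
    unfolding cos_moment_Suc by (simp add: algebra_simps)
  finally have S: "?S \<longlonglongrightarrow> cos_moment a b (Suc m) (i - j)" .
  have "\<forall>\<^sub>F N in sequentially. ?S N =
      L2_inner (\<mu> N) ([:0, 1:] ^ Suc m * P N (nat (int N + i))) (P N (nat (int N + j)))"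
    \<comment> \<open>This threshold makes the shifted index at least 1, so the recurrence has its
      third term and \<open>k - 1\<close> is a genuine predecessor.\<close>
    using eventually_ge_at_top[of "nat \<bar>i\<bar> + 1"]
  proof eventually_elim
    case (elim N)
    have N: "admissible_measure (\<mu> N)" "orthonormal_polys (\<mu> N) (P N)"
      using elim sys[of N] by auto
    define k where "k = nat (int N + i)"
    have k: "nat (int N + (i + 1)) = Suc k" "nat (int N + (i - 1)) = k - 1" "k \<noteq> 0"
    proof -
      have pos: "int N + i \<ge> 1" using elim by linarith
      then have int_k: "int k = int N + i" by (simp add: k_def)
      with pos show "k \<noteq> 0" by linarith
      have "int N + (i + 1) = int (Suc k)" "int N + (i - 1) = int k - 1"
        using int_k by simp_all
      then show "nat (int N + (i + 1)) = Suc k" "nat (int N + (i - 1)) = k - 1"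
        by (simp_all only: nat_int nat_diff_distrib' of_nat_0_le_iff zero_le_one nat_one_as_int)
    qed
    have "[:0, 1:] ^ Suc m * P N k = [:0, 1:] ^ m * ([:0, 1:] * P N k)"
      by (simp only: power_Suc2 mult.assoc)
    also have "\<dots> = Polynomial.smult (rec_a (\<mu> N) (P N) k) ([:0, 1:] ^ m * P N (Suc k))
        + Polynomial.smult (rec_b (\<mu> N) (P N) k) ([:0, 1:] ^ m * P N k)
        + Polynomial.smult (rec_a (\<mu> N) (P N) (k - 1)) ([:0, 1:] ^ m * P N (k - 1))"
      unfolding x_P_expansion[OF N] using k(3) by (simp only: if_False distrib_left mult_smult_right)
    finally show ?case
      unfolding k k_def[symmetric] by (simp only: L2_inner_add_left[OF N] L2_inner_smult_left[OF N])
  qed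
  with S show ?case by (rule Lim_transform_eventually)
qed

section \<open>Passage to the limit in the moments\<close>

theorem theorem4p3:
  fixes \<mu> :: "nat \<Rightarrow> real measure"
    and P :: "nat \<Rightarrow> nat \<Rightarrow> real poly"
    and \<P> :: "nat \<Rightarrow> (nat \<Rightarrow> real) measure"
    and a b :: real
  assumes "\<And>N. N \<ge> 1 \<Longrightarrow> real_OP_ensemble N (\<mu> N) (P N) (\<P> N)"
    and "a > 0"
    and "\<And>k :: int. (\<lambda>N. rec_a (\<mu> N) (P N) (nat (int N + k))) \<longlonglongrightarrow> a"
    and "\<And>k :: int. (\<lambda>N. rec_b (\<mu> N) (P N) (nat (int N + k))) \<longlonglongrightarrow> b"
  shows "(\<forall>N\<ge>1. prob_space (Q_measure N (\<mu> N) (P N))) \<and>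
         prob_space (Q_limit a b) \<and>
         converges_in_moments (\<lambda>N. Q_measure N (\<mu> N) (P N)) (Q_limit a b)"
proof -
  have sys: "admissible_measure (\<mu> N) \<and> orthonormal_polys (\<mu> N) (P N)" if "N \<ge> 1" for N
    using assms(1)[OF that] by (simp add: real_OP_ensemble_def)
  have "(\<lambda>N. \<integral>(x, y). x ^ m * y ^ n \<partial>Q_measure N (\<mu> N) (P N))
      \<longlonglongrightarrow> (\<integral>(x, y). x ^ m * y ^ n \<partial>Q_limit a b)" for m n
  proof -
    let ?I = "\<lambda>m i j N. L2_inner (\<mu> N) ([:0, 1:] ^ m * P N (nat (int N + i))) (P N (nat (int N + j)))"
    \<comment> \<open>The moment formula for \<open>Q_measure\<close>, with the indices
      \<open>N\<close> and \<open>N - 1\<close> written as the shifts 0 and -1.\<close>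
    let ?S = "\<lambda>N. (?I m 0 0 N * ?I n (-1) (-1) N + ?I m (-1) (-1) N * ?I n 0 0 N) / 2
        - ?I m 0 (-1) N * ?I n 0 (-1) N"
    have I: "?I m i j \<longlonglongrightarrow> cos_moment a b m (i - j)" for m i j
      by (rule L2_inner_power_limit[OF sys assms(3,4)])
    \<comment> \<open>Only the index differences enter the limit: the two averaged diagonal products
      both tend to the product at frequency 0, and the mixed one tends to the product at frequency
      1, as in the moments of \<open>Q_limit\<close>.\<close>
    have "?S \<longlonglongrightarrow>
        (cos_moment a b m (0 - 0) * cos_moment a b n (-1 - -1)
          + cos_moment a b m (-1 - -1) * cos_moment a b n (0 - 0)) / 2
        - cos_moment a b m (0 - -1) * cos_moment a b n (0 - -1)"
      by (intro tendsto_intros I) simp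
    then have S: "?S \<longlonglongrightarrow> (\<integral>(x, y). x ^ m * y ^ n \<partial>Q_limit a b)"
      using Q_limit_moments(1)[OF assms(2), of b m n] by (simp add: has_bochner_integral_iff)
    have "\<forall>\<^sub>F N in sequentially. ?S N = (\<integral>(x, y). x ^ m * y ^ n \<partial>Q_measure N (\<mu> N) (P N))"
      using eventually_ge_at_top[of 1]
    proof eventually_elim
      case (elim N)
      have nat: "nat (int N + 0) = N" "nat (int N + -1) = N - 1" using elim by auto
      show ?case
        unfolding nat
        using Q_measure_moments(1)[OF conjunct1[OF sys[OF elim]] conjunct2[OF sys[OF elim]] elim, of m n]
        by (simp only: has_bochner_integral_iff)
    qed
    with S show ?thesis by (rule Lim_transform_eventually)
  qed
  moreover have "integrable (Q_measure N (\<mu> N) (P N)) (\<lambda>(x, y). x ^ m * y ^ n)" if "N \<ge> 1" for N m n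
    using Q_measure_moments(1)[OF conjunct1[OF sys[OF that]] conjunct2[OF sys[OF that]] that]
    by (simp only: has_bochner_integral_iff)
  moreover have "integrable (Q_limit a b) (\<lambda>(x, y). x ^ m * y ^ n)" for m n
    using Q_limit_moments(1)[OF assms(2)] by (simp only: has_bochner_integral_iff)
  ultimately show ?thesis
    using Q_measure_moments(2) sys Q_limit_moments(2)[OF assms(2)]
    by (auto simp: converges_in_moments_def)
qed

end
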